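(* Suppose that $V=\oplus_{q\in\frac12\mathbb{Z}}V_{(q)}$ is a simple vertex operator superalgebra such that $V_{(\frac32)}+V_{(2)}$ strongly generates $V$. Then the bilinear form $\langle\cdot,\cdot\rangle$ on $V_{(2)}$ defined by $a_3b=\langle a,b\rangle\mathbf 1$ for $a,b\in V_{(2)}$ and the bilinear form $\langle\cdot,\cdot\rangle$ on $V_{(\frac32)}$ defined by $u_2v=\langle u,v\rangle\mathbf 1$ for $u,v\in V_{(\frac32)}$ are non-degenerate.
   Context: A vertex operator superalgebra is $(V,Y,\mathbf 1,\omega)$ with $V=\oplus_{q\in\frac12\mathbb{Z}}V_{(q)}$ a complex vector space with parity decomposition $V^{\bar0}=\oplus_{n\in\mathbb{Z}}V_{(n)}$, $V^{\bar1}=\oplus_{n\in\mathbb{Z}}V_{(n+\frac12)}$, a linear map $Y(v,z)=\sum_n v_nz^{-n-1}\in(\mathrm{End}\,V)[[z,z^{-1}]]$, and even vectors $\mathbf 1,\omega$, such that: $u_nv\in V^{\alpha+\beta}$ for $u\in V^\alpha,v\in V^\beta$ and $u_nv=0$ for $n$ large; for parity-homogeneous $u,v$ and $m,n,k\in\mathbb{Z}$, $\sum_{i\ge0}(-1)^i\binom mi(u_{m+k-i}v_{n+i}-(-1)^{|u||v|}(-1)^mv_{m+n-i}u_{k+i})=\sum_{i\ge0}\binom ki(u_{m+i}v)_{n+k-i}$ (Jacobi identity); $\mathbf 1_mv=\delta_{m,-1}v$, $v_{-1}\mathbf 1=v$, $v_n\mathbf 1=0$ for $n\ge0$; $L(n)=\omega_{n+1}$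 satisfy $[L(m),L(n)]=(m-n)L(m+n)+\frac{m^3-m}{12}\delta_{m+n,0}c_V$ for some $c_V\in\mathbb{C}$; $Y(L(-1)v,z)=\frac{d}{dz}Y(v,z)$; $V_{(q)}=\{v: L(0)v=qv\}$; $\dim V_{(q)}<\infty$ for all $q$ and $V_{(q)}=0$ for $q$ sufficiently negative. $V$ is strongly generated by a subset $T$ if $V$ is spanned by $\mathbf 1$ and the vectors $a^{(1)}_{-n_1}\cdots a^{(r)}_{-n_r}\mathbf 1$ with $r\ge1$, $a^{(i)}\in T$, $n_i$ positive integers. For $V$ strongly generated by $V_{(\frac32)}+V_{(2)}$ one has $V_{(0)}=\mathbb{C}\mathbf 1$, so the forms are well defined. An ideal is a subspace $I$ with $v_nI\subset I$ and $x_nv\in I$ for all $v\in V$, $x\in I$, $n\in\mathbb{Z}$; $V$ is simple if $V\neq0$ and its only ideals are $0$ and $V$. *)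

theory Defs
  imports Complex_Main "HOL-Library.Z2" "HOL-Library.Groups_Big_Fun" "HOL-Library.Set_Algebras"
begin

definition half_ints :: "rat set" where
  "half_ints = {of_int k / 2 | k :: int. True}"

text \<open>
  The underlying space \<open>V\<close> is the whole type \<open>'v\<close> with scalar multiplication \<open>scale\<close>. The
  homogeneous component of weight \<open>q\<close> is \<open>grade q\<close>; only its values at \<open>q \<in> half_ints\<close>
  matter. The vertex operator map is given by its modes: \<open>mode u n v\<close> is \<open>u\<^sub>n v\<close>, where
  \<open>Y(u,z) = \<Sum>\<^sub>n u\<^sub>n z\<^sup>-\<^sup>n\<^sup>-\<^sup>1\<close>.
\<close>
locale vosa_data = vector_space scale
  for scale :: "complex \<Rightarrow> 'v::ab_group_add \<Rightarrow> 'v" (infixr \<open>*s\<close> 75) +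
  fixes grade :: "rat \<Rightarrow> 'v set"
    and mode :: "'v \<Rightarrow> int \<Rightarrow> 'v \<Rightarrow> 'v"
    and vac :: 'v
    and conf :: 'v
begin

text \<open>The whole space is the internal direct sum of the subspaces \<open>W q\<close>, \<open>q \<in> I\<close>.\<close>
definition is_direct_sum :: "'i set \<Rightarrow> ('i \<Rightarrow> 'v set) \<Rightarrow> bool" where
  "is_direct_sum I W \<longleftrightarrow> (\<forall>q\<in>I. subspace (W q)) \<and>
     (\<forall>v. \<exists>!f. (\<forall>q\<in>I. f q \<in> W q) \<and> (\<forall>q. q \<notin> I \<longrightarrow> f q = 0) \<and>
              finite {q. f q \<noteq> 0} \<and> v = (\<Sum>q | f q \<noteq> 0. f q))"

definition bilinear_form_on :: "'v set \<Rightarrow> ('v \<Rightarrow> 'v \<Rightarrow> complex) \<Rightarrow> bool" where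
  "bilinear_form_on W B \<longleftrightarrow>
     (\<forall>x\<in>W. \<forall>y\<in>W. \<forall>z\<in>W. B (x + y) z = B x z + B y z \<and> B z (x + y) = B z x + B z y) \<and>
     (\<forall>c. \<forall>x\<in>W. \<forall>y\<in>W. B (c *s x) y = c * B x y \<and> B x (c *s y) = c * B x y)"

definition nondegenerate_bilinear_form_on :: "'v set \<Rightarrow> ('v \<Rightarrow> 'v \<Rightarrow> complex) \<Rightarrow> bool" where
  "nondegenerate_bilinear_form_on W B \<longleftrightarrow> bilinear_form_on W B \<and>
     (\<forall>x\<in>W. (\<forall>y\<in>W. B x y = 0) \<longrightarrow> x = 0) \<and>
     (\<forall>y\<in>W. (\<forall>x\<in>W. B x y = 0) \<longrightarrow> y = 0)"

definition parity :: "bit \<Rightarrow> 'v set" where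
  "parity \<alpha> = span (\<Union>n::int. grade (of_int n + (if \<alpha> = 0 then 0 else 1/2)))"

definition L :: "int \<Rightarrow> 'v \<Rightarrow> 'v" where
  "L n = mode conf (n + 1)"

definition strongly_generated_by :: "'v set \<Rightarrow> bool" where
  "strongly_generated_by T \<longleftrightarrow>
     span (insert vac {foldr (\<lambda>(a, n). mode a (- n)) xs vac | xs :: ('v \<times> int) list.
                         xs \<noteq> [] \<and> (\<forall>(a, n)\<in>set xs. a \<in> T \<and> n > 0)}) = UNIV"

definition ideal :: "'v set \<Rightarrow> bool" where
  "ideal I \<longleftrightarrow> subspace I \<and> (\<forall>v. \<forall>x\<in>I. \<forall>n. mode v n x \<in> I \<and> mode x n v \<in> I)"

definition simple :: bool where
  "simple \<longleftrightarrow> (UNIV :: 'v set) \<noteq> {0} \<and> (\<forall>I. ideal I \<longrightarrow> I = {0} \<or> I = UNIV)"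

text \<open>
  The scalar \<open>\<langle>a,b\<rangle>\<close> with \<open>a\<^sub>n b = \<langle>a,b\<rangle> \<one>\<close>. It is only meaningful where such a scalar exists and is
  unique; see \<open>form_2\<close> and \<open>form_3_2\<close> below.
\<close>
definition form :: "int \<Rightarrow> 'v \<Rightarrow> 'v \<Rightarrow> complex" where
  "form n a b = (THE c. mode a n b = c *s vac)"

end

text \<open>The sign \<open>(-1)\<^sup>\<alpha>\<^sup>\<beta>\<close>.\<close>
definition koszul_sign :: "bit \<Rightarrow> bit \<Rightarrow> complex" where
  "koszul_sign \<alpha> \<beta> = (if \<alpha> = 1 \<and> \<beta> = 1 then -1 else 1)"

text \<open>
  The sums over \<open>i \<ge> 0\<close> in the Jacobi identity, applied to a vector \<open>w\<close>, have finitely many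
  non-zero terms by \<open>truncation\<close>, so that \<open>Sum_any\<close> is the intended sum.
  The axiom \<open>translation\<close> is \<open>Y(L(-1)v,z) = d/dz Y(v,z)\<close> read off at \<open>z\<^sup>-\<^sup>n\<^sup>-\<^sup>1\<close>.
\<close>
locale vertex_operator_superalgebra = vosa_data scale grade mode vac conf
  for scale :: "complex \<Rightarrow> 'v::ab_group_add \<Rightarrow> 'v" (infixr \<open>*s\<close> 75)
    and grade mode vac conf +
  assumes grading: "is_direct_sum half_ints grade"
    and mode_linear_right: "Vector_Spaces.linear scale scale (mode u n)"
    and mode_linear_left: "Vector_Spaces.linear scale scale (\<lambda>u. mode u n v)"
    and vac_even: "vac \<in> parity 0"
    and conf_even: "conf \<in> parity 0"
    and mode_parity: "\<lbrakk>u \<in> parity \<alpha>; v \<in> parity \<beta>\<rbrakk> \<Longrightarrow> mode u n v \<in> parity (\<alpha> + \<beta>)"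
    and truncation: "\<exists>N. \<forall>n\<ge>N. mode u n v = 0"
    and jacobi: "\<lbrakk>u \<in> parity \<alpha>; v \<in> parity \<beta>\<rbrakk> \<Longrightarrow>
      Sum_any (\<lambda>i::nat. ((-1) ^ i * (of_int m gchoose i)) *s
          (mode u (m + k - int i) (mode v (n + int i) w)
           - (koszul_sign \<alpha> \<beta> * (-1) powi m) *s mode v (m + n - int i) (mode u (k + int i) w)))
      = Sum_any (\<lambda>i::nat. (of_int k gchoose i) *s mode (mode u (m + int i) v) (n + k - int i) w)"
    and vacuum: "mode vac m v = (if m = -1 then v else 0)"
    and creation: "mode v (-1) vac = v"
    and creation_regular: "n \<ge> 0 \<Longrightarrow> mode v n vac = 0"
    and virasoro: "\<exists>c. \<forall>m n v. L m (L n v) - L n (L m v) =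
      of_int (m - n) *s L (m + n) v
      + (of_int (m ^ 3 - m) / 12 * (if m + n = 0 then 1 else 0) * c) *s v"
    and translation: "mode (L (-1) v) n w = of_int (- n) *s mode v (n - 1) w"
    and grade_eigenspace: "q \<in> half_ints \<Longrightarrow> grade q = {v. L 0 v = of_rat q *s v}"
    and grade_finite_dim: "q \<in> half_ints \<Longrightarrow> \<exists>B. finite B \<and> span B = grade q"
    and grade_bounded_below: "\<exists>N. \<forall>q\<in>half_ints. q < N \<longrightarrow> grade q = {0}"
begin

lemma mode_right:
  "mode u n (v + w) = mode u n v + mode u n w" "mode u n (c *s v) = c *s mode u n v" "mode u n 0 = 0"
proof -
  interpret R: Vector_Spaces.linear scale scale "mode u n"
    by (rule mode_linear_right)
  show "mode u n (v + w) = mode u n v + mode u n w" "mode u n (c *s v) = c *s mode u n v"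
    "mode u n 0 = 0"
    by (rule R.add R.scale R.zero)+
qed

lemma mode_left:
  "mode (u + v) n w = mode u n w + mode v n w" "mode (c *s u) n w = c *s mode u n w" "mode 0 n w = 0"
proof -
  interpret R: Vector_Spaces.linear scale scale "\<lambda>u. mode u n w"
    by (rule mode_linear_left)
  show "mode (u + v) n w = mode u n w + mode v n w" "mode (c *s u) n w = c *s mode u n w"
    "mode 0 n w = 0"
    by (rule R.add R.scale R.zero)+
qed

lemma half_ints_cases:
  assumes "q \<in> half_ints"
  obtains n :: int where "q = of_int n" | n :: int where "q = of_int n + 1/2"
proof -
  obtain k :: int where k: "q = of_int k / 2"
    using assms by (auto simp: half_ints_def)
  show thesis
  proof (cases "even k")
    case True
    then obtain m where "k = 2 * m" by blast
    with k that(1)[of m] show thesis by simp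
  next
    case False
    then obtain m where "k = 2 * m + 1" by (elim oddE)
    with k that(2)[of m] show thesis by (simp add: field_simps)
  qed
qed

lemma half_ints_add: "p \<in> half_ints \<Longrightarrow> q \<in> half_ints \<Longrightarrow> p + q \<in> half_ints"
  unfolding half_ints_def
  by (auto simp: add_divide_distrib[symmetric] simp flip: of_int_add)

lemma half_ints_of_int: "of_int n \<in> half_ints"
  unfolding half_ints_def by (auto intro!: exI[of _ "2 * n"])

lemma half_ints_3_2: "3/2 \<in> half_ints"
  unfolding half_ints_def by (auto intro!: exI[of _ 3])

lemma grade_parity:
  assumes "q \<in> half_ints" "v \<in> grade q"
  obtains \<alpha> where "v \<in> parity \<alpha>"
  using assms(1)
proof (cases rule: half_ints_cases)
  case (1 n)
  then have "v \<in> parity 0"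
    using assms(2) unfolding parity_def by (auto intro!: span_base)
  then show thesis by (rule that)
next
  case (2 n)
  then have "v \<in> parity 1"
    using assms(2) unfolding parity_def by (auto intro!: span_base)
  then show thesis by (rule that)
qed

lemma L0_mode:
  assumes "u \<in> parity \<alpha>"
  shows "L 0 (mode u n w) - mode u n (L 0 w) = mode (L 0 u) n w - of_int (n + 1) *s mode u n w"
proof -
  have "Sum_any (\<lambda>i::nat. ((-1) ^ i * (of_int 0 gchoose i)) *s
          (mode conf (0 + 1 - int i) (mode u (n + int i) w)
           - (koszul_sign 0 \<alpha> * (-1) powi 0) *s mode u (0 + n - int i) (mode conf (1 + int i) w)))
      = Sum_any (\<lambda>i::nat. (of_int 1 gchoose i) *s mode (mode conf (0 + int i) u) (n + 1 - int i) w)"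
    (is "Sum_any ?f = Sum_any ?g")
    by (rule jacobi[OF conf_even assms])
  moreover have "Sum_any ?f = sum ?f {0}"
    by (rule Sum_any.expand_superset) (auto simp: gbinomial_0_left split: if_splits)
  moreover have "Sum_any ?g = sum ?g {0, 1}"
  proof (rule Sum_any.expand_superset)
    have "(1::complex) gchoose i = 0" if "i \<noteq> 0" "i \<noteq> 1" for i
      using that binomial_gbinomial[of 1 i, where 'a = complex] by (simp add: binomial_eq_0)
    then show "{i. ?g i \<noteq> 0} \<subseteq> {0, 1}" by auto
  qed simp
  moreover have "mode (mode conf 0 u) (n + 1) w = - (of_int (n + 1) *s mode u n w)"
    using translation[of u "n + 1" w] by (simp add: L_def scale_left_distrib scale_left_diff_distrib)
  ultimately show ?thesis
    by (simp add: L_def koszul_sign_def)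
qed

lemma grade_mode:
  assumes "p \<in> half_ints" "q \<in> half_ints" "u \<in> grade p" "w \<in> grade q"
  shows "mode u n w \<in> grade (p + q + of_int (- n - 1))"
proof -
  obtain \<alpha> where "u \<in> parity \<alpha>"
    using grade_parity[OF assms(1,3)] .
  from L0_mode[OF this, of n w] assms
  have "L 0 (mode u n w) = of_rat (p + q + of_int (- n - 1)) *s mode u n w"
    by (simp add: grade_eigenspace mode_left mode_right algebra_simps of_rat_add of_rat_diff)
  then show ?thesis
    using assms by (subst grade_eigenspace) (auto intro!: half_ints_add half_ints_of_int simp del: of_int_diff of_int_minus)
qed

lemma subspace_grade: "q \<in> half_ints \<Longrightarrow> subspace (grade q)"
  using grading by (simp add: is_direct_sum_def)

lemma vac_grade: "vac \<in> grade 0"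
  using half_ints_of_int[of 0] by (simp add: grade_eigenspace L_def creation_regular)

lemma grade_0:
  assumes "strongly_generated_by (grade (3/2) + grade 2)"
  shows "grade 0 = span {vac}"
proof
  show "span {vac} \<subseteq> grade 0"
    using vac_grade subspace_grade[of 0] half_ints_of_int[of 0] by (intro span_minimal) auto
  define H where "H = (\<Union>q\<in>{q\<in>half_ints. q > 0}. grade q)"
  define S where "S = {c *s vac + y | c y. y \<in> span H}"
  have S: "subspace S"
  proof (rule subspaceI)
    show "0 \<in> S" unfolding S_def using span_zero by (auto intro!: exI[of _ 0])
  next
    fix x y assume "x \<in> S" "y \<in> S"
    then obtain a b x' y' where *: "x = a *s vac + x'" "y = b *s vac + y'" "x' \<in> span H" "y' \<in> span H"
      unfolding S_def by blast
    then have "x + y = (a + b) *s vac + (x' + y')" by (simp add: algebra_simps)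
    then show "x + y \<in> S" unfolding S_def using * span_add by blast
  next
    fix c x assume "x \<in> S"
    then obtain a x' where *: "x = a *s vac + x'" "x' \<in> span H"
      unfolding S_def by blast
    then have "c *s x = (c * a) *s vac + c *s x'" by (simp add: algebra_simps)
    then show "c *s x \<in> S" unfolding S_def using * span_scale by blast
  qed
  have HS: "span H \<subseteq> S"
  proof
    fix y assume "y \<in> span H"
    then show "y \<in> S" unfolding S_def by (intro CollectI exI[of _ 0] exI[of _ y]) simp
  qed
  have vacS: "vac \<in> S" unfolding S_def by (intro CollectI exI[of _ 1] exI[of _ 0]) (simp add: span_zero)
  have step: "mode a (- n) x \<in> span H"
    if a: "a \<in> grade p" "p = 3/2 \<or> p = 2" and n: "n > 0" and x: "x \<in> S" for a p x n
  proof -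
    have p: "p \<in> half_ints"
      using a(2) half_ints_3_2 half_ints_of_int[of 2] by (elim disjE; hypsubst) simp_all
    have p1: "p > 1"
      using a(2) by auto
    have *: "mode a (- n) y \<in> span H" if "y \<in> grade q" "q \<in> half_ints" "q \<ge> 0" for y q
    proof (rule span_base)
      have "p + q + of_int (n - 1) > 0"
        using p1 n that by (intro add_pos_nonneg) auto
      moreover have "p + q + of_int (n - 1) \<in> half_ints"
        by (intro half_ints_add p that half_ints_of_int)
      ultimately show "mode a (- n) y \<in> H"
        unfolding H_def using grade_mode[OF p that(2) a(1) that(1), of "- n"] by auto
    qed
    from x obtain c y where x: "x = c *s vac + y" "y \<in> span H" unfolding S_def by blast
    have "mode a (- n) y \<in> span H" using x(2)
    proof (induction rule: span_induct_alt)
      case base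
      then show ?case by (simp add: mode_right span_zero)
    next
      case (step d z y)
      from step(1) obtain q where "z \<in> grade q" "q \<in> half_ints" "q > 0"
        unfolding H_def by blast
      then have "mode a (- n) z \<in> span H" by (intro *) auto
      with step show ?case by (simp add: mode_right span_add span_scale)
    qed
    moreover have "mode a (- n) vac \<in> span H"
      using *[OF vac_grade] half_ints_of_int[of 0] by simp
    ultimately show ?thesis
      by (simp add: x mode_right span_add span_scale)
  qed
  have gen: "foldr (\<lambda>(a, n). mode a (- n)) xs vac \<in> S"
    if "\<forall>(a, n)\<in>set xs. a \<in> grade (3/2) + grade 2 \<and> n > 0" for xs :: "('v \<times> int) list"
    using that
  proof (induction xs)
    case Nil
    then show ?case using vacS by simp
  next
    case (Cons an xs)
    obtain a n where an: "an = (a, n)" by force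
    with Cons obtain u v where uv: "a = u + v" "u \<in> grade (3/2)" "v \<in> grade 2" "n > 0"
      by (auto elim: set_plus_elim)
    let ?y = "foldr (\<lambda>(a, n). mode a (- n)) xs vac"
    have y: "?y \<in> S" using Cons by simp
    have "mode u (- n) ?y + mode v (- n) ?y \<in> span H"
      by (intro span_add step[OF uv(2) _ uv(4) y] step[OF uv(3) _ uv(4) y]) auto
    then show ?case using HS by (auto simp: an uv(1) mode_left)
  qed
  have "insert vac {foldr (\<lambda>(a, n). mode a (- n)) xs vac | xs :: ('v \<times> int) list.
      xs \<noteq> [] \<and> (\<forall>(a, n)\<in>set xs. a \<in> grade (3/2) + grade 2 \<and> n > 0)} \<subseteq> S"
    using vacS gen by blast
  from span_minimal[OF this S] have "UNIV \<subseteq> S"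
    using assms by (simp only: strongly_generated_by_def)
  show "grade 0 \<subseteq> span {vac}"
  proof
    fix v assume v: "v \<in> grade 0"
    from \<open>UNIV \<subseteq> S\<close> obtain c y where vy: "v = c *s vac + y" "y \<in> span H" unfolding S_def by blast
    have 0: "0 \<in> half_ints" using half_ints_of_int[of 0] by simp
    have "y = v - c *s vac" by (simp add: vy)
    then have y0: "y \<in> grade 0"
      using v vac_grade subspace_grade[OF 0] by (simp add: subspace_diff subspace_scale)
    define D where "D = (\<lambda>f. (\<forall>q\<in>half_ints. f q \<in> grade q) \<and> (\<forall>q. q \<notin> half_ints \<longrightarrow> f q = 0) \<and>
      finite {q. f q \<noteq> 0})"
    have uniq: "f = g" if "D f" "D g" "(\<Sum>q | f q \<noteq> 0. f q) = (\<Sum>q | g q \<noteq> 0. g q)" for f g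
    proof -
      have "\<exists>!h. D h \<and> (\<Sum>q | f q \<noteq> 0. f q) = (\<Sum>q | h q \<noteq> 0. h q)"
        using grading unfolding is_direct_sum_def D_def by (simp only: conj_assoc)
      then show ?thesis using that by blast
    qed
    have D1: "D (\<lambda>q. if q = r then x else 0)" if "x \<in> grade r" "r \<in> half_ints" for x r
      using that subspace_0[OF subspace_grade] by (auto simp: D_def)
    have s1: "(\<Sum>q | (if q = r then x else 0) \<noteq> 0. if q = r then x else 0) = x" for x :: 'v and r :: rat
      by (cases "x = 0") auto
    have sany: "(\<Sum>q | f q \<noteq> 0. f q) = Sum_any f" for f :: "rat \<Rightarrow> 'v"
      by (simp add: Sum_any.expand_set)
    have Dadd: "D (\<lambda>q. f q + g q)" if "D f" "D g" for f g
      using that subspace_add[OF subspace_grade] unfolding D_def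
      by (auto intro: finite_subset[of _ "{q. f q \<noteq> 0} \<union> {q. g q \<noteq> 0}"])
    have "\<exists>f. D f \<and> f 0 = 0 \<and> y = Sum_any f"
      using vy(2)
    proof (induction rule: span_induct_alt)
      case base
      show ?case
        using subspace_0[OF subspace_grade] by (intro exI[of _ "\<lambda>_. 0"]) (auto simp: D_def)
    next
      case (step d z y)
      then obtain f where f: "D f" "f 0 = 0" "y = Sum_any f" by blast
      from step obtain q where q: "q \<in> half_ints" "q > 0" "z \<in> grade q" by (auto simp: H_def)
      then have z: "d *s z \<in> grade q" using subspace_grade subspace_scale by blast
      define g where "g = (\<lambda>p. if p = q then d *s z else 0)"
      have g: "D g" unfolding g_def by (rule D1[OF z q(1)])
      have gz: "Sum_any g = d *s z"
        using s1[of q "d *s z"] by (simp add: sany g_def)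
      have "Sum_any (\<lambda>q. g q + f q) = d *s z + y"
        using f g gz by (subst Sum_any.distrib) (auto simp: D_def)
      with Dadd[OF g f(1)] f(2) q(2) show ?case
        by (intro exI[of _ "\<lambda>q. g q + f q"]) (auto simp: g_def)
    qed
    then obtain f where f: "D f" "f 0 = 0" "y = Sum_any f" by blast
    have "f = (\<lambda>q. if q = 0 then y else 0)"
      by (rule uniq[OF f(1) D1[OF y0 0]]) (simp only: s1 sany f(3))
    with f(2) have "y = 0" by metis
    then show "v \<in> span {vac}" using vy by (simp add: span_base span_scale)
  qed
qed

lemma form_unique:
  assumes "simple" "mode a n b = c *s vac"
  shows "mode a n b = form n a b *s vac"
proof -
  have "vac \<noteq> 0"
  proof
    assume "vac = 0"
    then have "v = 0" for v :: 'v
      using vacuum[of "-1" v] by (simp add: mode_left)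
    then show False using assms(1) by (auto simp: simple_def)
  qed
  then have "\<exists>!c. mode a n b = c *s vac"
    using assms(2) by (intro ex1I[of _ c]) auto
  then show ?thesis unfolding form_def by (rule theI')
qed

text \<open>The two forms are well defined.\<close>

lemma form_2:
  assumes "simple" "strongly_generated_by (grade (3/2) + grade 2)" "a \<in> grade 2" "b \<in> grade 2"
  shows "mode a 3 b = form 3 a b *s vac"
proof -
  have "mode a 3 b \<in> grade 0"
    using grade_mode[OF _ _ assms(3,4), of 3] half_ints_of_int[of 2] by simp
  then obtain c where "mode a 3 b = c *s vac"
    by (auto simp: grade_0[OF assms(2)] span_singleton)
  then show ?thesis by (rule form_unique[OF assms(1)])
qed

lemma form_3_2:
  assumes "simple" "strongly_generated_by (grade (3/2) + grade 2)"
    "u \<in> grade (3/2)" "v \<in> grade (3/2)"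
  shows "mode u 2 v = form 2 u v *s vac"
proof -
  have "mode u 2 v \<in> grade 0"
    using grade_mode[OF _ _ assms(3,4), of 2] half_ints_3_2 by simp
  then obtain c where "mode u 2 v = c *s vac"
    by (auto simp: grade_0[OF assms(2)] span_singleton)
  then show ?thesis by (rule form_unique[OF assms(1)])
qed

end

end

theory Submission
  imports Defs
begin

text \<open>
  For \<open>x\<close> in \<open>V\<close>, ask whether some \<open>v\<^sub>n x\<close> has a non-zero component along the vacuum. The \<open>x\<close> for
  which this never happens form an ideal, the vacuum radical (\<open>mode_vacuum_radical\<close>,
  \<open>vacuum_radical_mode\<close>); in a simple algebra \<open>\<one> \<noteq> 0\<close> is not in it, so it is zero
  (\<open>vacuum_radical_zero\<close>). It is therefore enough to show that the kernel of each of the two forms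
  lies in the vacuum radical.

  Strong generation in weights \<open>3/2\<close> and \<open>2\<close> leaves no weights below \<open>3/2\<close> other than \<open>0\<close>, where
  only the multiples of \<open>\<one>\<close> occur. Hence having no vacuum component means lying in the span
  of the components of positive weight, here called the positive part, and \<open>L(1)\<close> maps everything
  into it: weight \<open>1\<close>, which it would send to weight \<open>0\<close>, is empty.

  Let \<open>a\<close> have weight \<open>h \<in> {3/2, 2}\<close> and pair trivially with the weight \<open>h\<close> component, that
  is, \<open>a\<^sub>d b\<close> has no vacuum component for \<open>d = 2h - 1\<close>. The vector \<open>L(1) a\<close> has weight \<open>1/2\<close> or
  \<open>1\<close> and vanishes, so \<open>[L(1), a\<^sub>n] = (2h - 2 - n) a\<^sub>n\<^sub>+\<^sub>1\<close>. The coefficient is non-zero for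
  \<open>n \<ge> d\<close>, and induction shows that no \<open>a\<^sub>n v\<close> with \<open>n \<ge> d\<close> has a vacuum component; for \<open>n < d\<close>
  the weights forbid one (\<open>form_kernel_positive_part\<close>). Skew symmetry exchanges \<open>a\<^sub>n v\<close> and \<open>v\<^sub>n a\<close>
  up to sign and terms of positive weight (\<open>mode_swap_positive_part\<close>), so \<open>a\<close> is in the vacuum
  radical. The same exchange reduces the right kernel of the form to the left kernel.
\<close>

section \<open>Modes on subspaces and half-integers\<close>

context vertex_operator_superalgebra
begin

lemma subspace_Sum_any: "subspace S \<Longrightarrow> (\<And>i. f i \<in> S) \<Longrightarrow> Sum_any f \<in> S"
  by (simp add: Sum_any.expand_set subspace_sum)

lemma mode_in_subspace:
  assumes "subspace S" "\<And>b. b \<in> B \<Longrightarrow> mode u n b \<in> S" "v \<in> span B"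
  shows "mode u n v \<in> S"
  using assms(3)
  by (induction rule: span_induct_alt)
    (auto simp: mode_right assms(2) intro!: subspace_0 subspace_add subspace_scale assms(1))

lemma mode_in_subspace_left:
  assumes "subspace S" "\<And>b. b \<in> B \<Longrightarrow> mode b n v \<in> S" "u \<in> span B"
  shows "mode u n v \<in> S"
  using assms(3)
  by (induction rule: span_induct_alt)
    (auto simp: mode_left assms(2) intro!: subspace_0 subspace_add subspace_scale assms(1))

lemma half_ints_diff_int: "q \<in> half_ints \<Longrightarrow> q - of_int n \<in> half_ints"
  using half_ints_add[OF _ half_ints_of_int[of "- n"], of q] by simp

lemma half_ints_0: "0 \<in> half_ints"
  using half_ints_of_int[of 0] by simp

lemma half_ints_3_2_or_2: "h = 3/2 \<or> h = 2 \<Longrightarrow> h \<in> half_ints"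
  using half_ints_3_2 half_ints_of_int[of 2] by (elim disjE; hypsubst) simp_all

section \<open>Weights and the Virasoro operators\<close>

text \<open>
  Eigenvectors of \<open>L 0\<close> for distinct eigenvalues are independent: a product of operators
  \<open>L 0 - p\<close>, \<open>p \<in> P\<close>, kills \<open>v\<close> as an element of the span, but acts on \<open>v\<close> as a non-zero
  scalar because \<open>q \<notin> P\<close>.
\<close>
lemma grade_independent:
  assumes q: "q \<in> half_ints" "q \<notin> P" and P: "P \<subseteq> half_ints"
    and v: "v \<in> grade q" "v \<in> span (\<Union>p\<in>P. grade p)"
  shows "v = 0"
proof -
  define K where "K = foldr (\<lambda>p w. L 0 w - of_rat p *s w)"
  have K_add: "K ps (x + y) = K ps x + K ps y" for ps x y
    by (induction ps) (simp_all add: K_def L_def mode_right algebra_simps)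
  have K_eigen: "K ps z = (\<Prod>p\<leftarrow>ps. of_rat (r - p)) *s z" if "r \<in> half_ints" "z \<in> grade r" for ps r z
    using that
    by (induction ps)
      (simp_all add: K_def grade_eigenspace L_def mode_right of_rat_diff algebra_simps)
  have "\<exists>ps. set ps \<subseteq> P \<and> K ps v = 0"
    using v(2)
  proof (induction rule: span_induct_alt)
    case base
    show ?case by (rule exI[of _ "[]"]) (simp add: K_def)
  next
    case (step c z y)
    then obtain ps p where ps: "set ps \<subseteq> P" "K ps y = 0" and p: "p \<in> P" "z \<in> grade p" by blast
    have "c *s z \<in> grade p"
      using p P subspace_grade subspace_scale by blast
    then have "K (p # ps) (c *s z) = 0"
      using K_eigen[of p "c *s z" "p # ps"] p P by auto
    moreover have "K (p # ps) y = 0"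
      using ps by (simp add: K_def L_def mode_right)
    ultimately show ?case
      using ps p by (intro exI[of _ "p # ps"]) (simp add: K_add)
  qed
  then obtain ps where ps: "set ps \<subseteq> P" "K ps v = 0" by blast
  have "(\<Prod>p\<leftarrow>ps. of_rat (q - p)) \<noteq> (0::complex)"
    using ps(1) q(2) by (auto simp: prod_list_zero_iff)
  with ps(2) K_eigen[OF q(1) v(1), of ps] show ?thesis by simp
qed

lemma L_grade:
  assumes "q \<in> half_ints" "v \<in> grade q"
  shows "L n v \<in> grade (q - of_int n)"
proof -
  have q: "q - of_int n \<in> half_ints"
    by (rule half_ints_diff_int[OF assms(1)])
  obtain c where c: "\<forall>m n v. L m (L n v) - L n (L m v) =
      of_int (m - n) *s L (m + n) v
      + (of_int (m ^ 3 - m) / 12 * (if m + n = 0 then 1 else 0) * c) *s v"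
    using virasoro by blast
  have "L 0 (L n v) - L n (L 0 v) = of_int (- n) *s L n v"
    using c[rule_format, of 0 n v] by simp
  then show ?thesis
    using assms q by (simp add: grade_eigenspace L_def mode_right of_rat_diff algebra_simps)
qed

text \<open>The commutator formula for \<open>L(1) = \<omega>\<^sub>2\<close>: the Jacobi identity with \<open>m = 0\<close> and \<open>k = 2\<close>.\<close>
lemma L1_mode:
  assumes "u \<in> parity \<alpha>"
  shows "L 1 (mode u n w) - mode u n (L 1 w)
    = of_int (- n - 2) *s mode u (n + 1) w + 2 *s mode (L 0 u) (n + 1) w + mode (L 1 u) n w"
proof -
  have "Sum_any (\<lambda>i::nat. ((-1) ^ i * (of_int 0 gchoose i)) *s
          (mode conf (0 + 2 - int i) (mode u (n + int i) w)
           - (koszul_sign 0 \<alpha> * (-1) powi 0) *s mode u (0 + n - int i) (mode conf (2 + int i) w)))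
      = Sum_any (\<lambda>i::nat. (of_int 2 gchoose i) *s mode (mode conf (0 + int i) u) (n + 2 - int i) w)"
    (is "Sum_any ?f = Sum_any ?g")
    by (rule jacobi[OF conf_even assms])
  moreover have "Sum_any ?f = sum ?f {0}"
    by (rule Sum_any.expand_superset) (auto simp: gbinomial_0_left split: if_splits)
  moreover have "Sum_any ?g = sum ?g {0, 1, 2}"
  proof (rule Sum_any.expand_superset)
    have "(2::complex) gchoose i = 0" if "i \<noteq> 0" "i \<noteq> 1" "i \<noteq> 2" for i
      using that binomial_gbinomial[of 2 i, where 'a = complex] by (simp add: binomial_eq_0)
    then show "{i. ?g i \<noteq> 0} \<subseteq> {0, 1, 2}" by auto
  qed simp
  moreover have two: "(2::complex) gchoose 2 = 1"
    using binomial_gbinomial[of 2 2, where 'a = complex] by simp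
  have "n + 2 - 1 = n + 1" by simp
  with two have "sum ?g {0, 1, 2} = mode (mode conf 0 u) (n + 2) w
      + 2 *s mode (mode conf 1 u) (n + 1) w + mode (mode conf 2 u) n w"
    by (simp add: add.assoc add.commute[of 1 n])
  moreover have "mode (mode conf 0 u) (n + 2) w = of_int (- n - 2) *s mode u (n + 1) w"
    using translation[of u "n + 2" w] by (simp add: L_def algebra_simps)
  ultimately show ?thesis
    by (simp add: L_def koszul_sign_def)
qed

section \<open>Skew symmetry and associativity\<close>

text \<open>
  This is the Jacobi identity applied to the vacuum with \<open>k = -1\<close>, \<open>n = 0\<close>. The vectors
  \<open>z\<^sub>-\<^sub>1\<^sub>-\<^sub>i \<one>\<close> on the right are \<open>L(-1)\<^sup>i z / i!\<close>.
\<close>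
lemma skew_symmetry:
  assumes u: "u \<in> parity \<alpha>" and v: "v \<in> parity \<beta>"
  shows "(koszul_sign \<alpha> \<beta> * (-1) powi m) *s mode v m u
    = - Sum_any (\<lambda>i::nat. (-1) ^ i *s mode (mode u (m + int i) v) (- 1 - int i) vac)"
proof -
  have "Sum_any (\<lambda>i::nat. ((-1) ^ i * (of_int m gchoose i)) *s
          (mode u (m + (-1) - int i) (mode v (0 + int i) vac)
           - (koszul_sign \<alpha> \<beta> * (-1) powi m) *s mode v (m + 0 - int i) (mode u (-1 + int i) vac)))
      = Sum_any (\<lambda>i::nat. (of_int (-1) gchoose i) *s mode (mode u (m + int i) v) (0 + (-1) - int i) vac)"
    (is "Sum_any ?f = Sum_any ?g")
    by (rule jacobi[OF u v])
  moreover have "Sum_any ?f = sum ?f {0}"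
  proof (rule Sum_any.expand_superset)
    have "?f i = 0" if "i \<noteq> 0" for i
      using that by (simp add: creation_regular mode_right)
    then show "{i. ?f i \<noteq> 0} \<subseteq> {0}" by blast
  qed simp
  moreover have "(-1::complex) gchoose i = (-1) ^ i" for i
    by (simp add: gbinomial_minus binomial_gbinomial[symmetric])
  ultimately show ?thesis
    by (simp add: creation creation_regular mode_right)
qed

text \<open>How skew symmetry is used: the sign is invertible, so it does not affect membership.\<close>
lemma skew_symmetry_subspace:
  assumes u: "u \<in> parity \<alpha>" and v: "v \<in> parity \<beta>" and S: "subspace S"
    and terms: "\<And>i. mode (mode u (m + int i) v) (- 1 - int i) vac \<in> S"
  shows "mode v m u \<in> S"
proof -
  let ?s = "koszul_sign \<alpha> \<beta> * (-1) powi m"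
  have "?s *s mode v m u \<in> S"
    unfolding skew_symmetry[OF u v]
    by (intro subspace_neg S subspace_Sum_any subspace_scale terms)
  then have "inverse ?s *s (?s *s mode v m u) \<in> S"
    by (rule subspace_scale[OF S])
  moreover have "inverse ?s * ?s = 1" by (simp add: koszul_sign_def)
  ultimately show ?thesis by (simp only: scale_scale scale_one)
qed

lemma span_parity_self: "span (parity \<alpha>) = parity \<alpha>"
  by (simp add: parity_def span_span)

lemma span_parity: "span (parity 0 \<union> parity 1) = UNIV"
proof -
  have "v \<in> span (parity 0 \<union> parity 1)" for v
  proof -
    obtain f where f: "\<forall>q\<in>half_ints. f q \<in> grade q" "\<forall>q. q \<notin> half_ints \<longrightarrow> f q = 0"
      "v = (\<Sum>q | f q \<noteq> 0. f q)"
      using grading unfolding is_direct_sum_def by blast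
    show ?thesis unfolding f(3)
    proof (rule span_sum)
      fix q assume "q \<in> {q. f q \<noteq> 0}"
      then have "q \<in> half_ints" using f(2) by blast
      then obtain \<alpha> where "f q \<in> parity \<alpha>"
        using f(1) grade_parity by blast
      then show "f q \<in> span (parity 0 \<union> parity 1)"
        by (cases \<alpha>) (auto intro: span_base)
    qed
  qed
  then show ?thesis by blast
qed

text \<open>
  Weak associativity. Choosing \<open>k\<close> so large that \<open>u\<^sub>k\<^sub>+\<^sub>i w = 0\<close> for all \<open>i \<ge> 0\<close> removes the swapped
  products from the Jacobi identity, which then expresses \<open>u\<^sub>p v\<^sub>n w\<close> by modes of single vectors
  applied to \<open>w\<close> and by products \<open>u\<^sub>p\<^sub>-\<^sub>i v\<^sub>n\<^sub>+\<^sub>i w\<close> with \<open>i > 0\<close>. The latter are handled by downward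
  induction on \<open>n\<close>, starting where truncation gives \<open>v\<^sub>n w = 0\<close>.
\<close>
lemma mode_mode_homogeneous:
  assumes u: "u \<in> parity \<alpha>" and v: "v \<in> parity \<beta>"
  shows "mode u p (mode v n w) \<in> span {mode y j w | y j. True}"
proof -
  let ?M = "span {mode y j w | y j. True}"
  have M: "subspace ?M" by simp
  have gen: "mode y j w \<in> ?M" for y j by (rule span_base) blast
  obtain N where N: "\<forall>n\<ge>N. mode v n w = 0" using truncation by blast
  obtain k where k: "\<forall>n\<ge>k. mode u n w = 0" using truncation by blast
  have "mode u p (mode v (N - int j) w) \<in> ?M" for j p
  proof (induction j arbitrary: p rule: less_induct)
    case (less j)
    \<comment> \<open>With this \<open>m\<close> the term \<open>i = 0\<close> on the left of the Jacobi identity is the product in question.\<close>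
    define m where "m = p - k"
    define f where "f i = ((-1) ^ i * (of_int m gchoose i)) *s
      mode u (p - int i) (mode v (N - int j + int i) w)" for i
    have "Sum_any (\<lambda>i::nat. ((-1) ^ i * (of_int m gchoose i)) *s
          (mode u (m + k - int i) (mode v (N - int j + int i) w)
           - (koszul_sign \<alpha> \<beta> * (-1) powi m) *s mode v (m + (N - int j) - int i) (mode u (k + int i) w)))
      = Sum_any (\<lambda>i::nat. (of_int k gchoose i) *s mode (mode u (m + int i) v) ((N - int j) + k - int i) w)"
      by (rule jacobi[OF u v])
    then have "Sum_any f = Sum_any (\<lambda>i::nat.
        (of_int k gchoose i) *s mode (mode u (m + int i) v) ((N - int j) + k - int i) w)"
      using k by (simp add: f_def[abs_def] m_def mode_right)
    also have "\<dots> \<in> ?M"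
      by (intro subspace_Sum_any M subspace_scale gen)
    finally have sum: "Sum_any f \<in> ?M" .
    have zero: "f i = 0" if "i \<ge> j" "i \<noteq> 0" for i
      using N that by (simp add: f_def mode_right)
    have "{i. f i \<noteq> 0} \<subseteq> insert 0 {1..<j}"
      using zero by (force simp: not_le)
    then have "Sum_any f = sum f (insert 0 {1..<j})"
      by (intro Sum_any.expand_superset) auto
    then have "f 0 = Sum_any f - sum f {1..<j}" by simp
    moreover have "sum f {1..<j} \<in> ?M"
    proof (intro subspace_sum M)
      fix i assume i: "i \<in> {1..<j}"
      then have "N - int j + int i = N - int (j - i)" by auto
      then have "mode u (p - int i) (mode v (N - int j + int i) w) \<in> ?M"
        using i by (simp only:) (rule less.IH, simp)
      then show "f i \<in> ?M"
        unfolding f_def by (rule subspace_scale[OF M])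
    qed
    ultimately have "f 0 \<in> ?M"
      using sum by (simp add: span_diff)
    then show ?case by (simp add: f_def)
  qed
  from this[of p "nat (N - n)"] N show ?thesis
    by (cases "n \<ge> N") (auto simp: mode_right span_zero)
qed

lemma mode_mode: "mode u p (mode v n w) \<in> span {mode y j w | y j. True}"
proof -
  let ?P = "parity 0 \<union> parity 1" and ?M = "span {mode y j w | y j. True}"
  have hom: "mode u p (mode y n w) \<in> ?M" if y: "y \<in> ?P" for y
  proof (rule mode_in_subspace_left[OF subspace_span])
    show "u \<in> span ?P" by (simp only: span_parity UNIV_I)
    show "mode x p (mode y n w) \<in> ?M" if "x \<in> ?P" for x
      using that y by (elim UnE) (rule mode_mode_homogeneous; assumption)+
  qed
  have "mode v n w \<in> span ((\<lambda>y. mode y n w) ` ?P)"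
  proof (rule mode_in_subspace_left[OF subspace_span])
    show "v \<in> span ?P" by (simp only: span_parity UNIV_I)
    show "mode y n w \<in> span ((\<lambda>y. mode y n w) ` ?P)" if "y \<in> ?P" for y
      using that by (intro span_base imageI)
  qed
  then show ?thesis
    by (rule mode_in_subspace[OF subspace_span, rotated]) (elim imageE, hypsubst, rule hom)
qed

section \<open>The vacuum radical\<close>

definition positive_part :: "'v set" where
  "positive_part = span (\<Union>q\<in>{q\<in>half_ints. q > 0}. grade q)"

lemma subspace_positive_part: "subspace positive_part"
  by (simp add: positive_part_def)

lemma grade_positive_part: "q \<in> half_ints \<Longrightarrow> q > 0 \<Longrightarrow> v \<in> grade q \<Longrightarrow> v \<in> positive_part"
  unfolding positive_part_def by (rule span_base) blast

lemma vac_positive_part: "vac \<in> positive_part \<Longrightarrow> vac = 0"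
  unfolding positive_part_def by (rule grade_independent[OF half_ints_0 _ _ vac_grade]) auto

lemma simple_vac_nonzero: "simple \<Longrightarrow> vac \<noteq> 0"
proof
  assume "simple" "vac = 0"
  then have "v = 0" for v :: 'v
    using vacuum[of "-1" v] by (simp add: mode_left)
  then show False using \<open>simple\<close> by (auto simp: simple_def)
qed

text \<open>
  Asking that \<open>v\<^sub>n x\<close> have no vacuum component for a single \<open>v\<close> at a time suffices to control
  iterated products \<open>v\<^sub>n w\<^sub>m x\<close>, because weak associativity rewrites these as sums of \<open>y\<^sub>j x\<close>.
\<close>
definition vacuum_radical :: "'v set" where
  "vacuum_radical = {x. \<forall>v n. mode v n x \<in> positive_part}"

lemma subspace_vacuum_radical: "subspace vacuum_radical"
  using subspace_positive_part
  by (intro subspaceI)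
    (auto simp: vacuum_radical_def mode_right intro: subspace_0 subspace_add subspace_scale)

lemma mode_vacuum_radical:
  assumes "x \<in> vacuum_radical"
  shows "mode w m x \<in> vacuum_radical"
proof -
  have "span {mode y j x | y j. True} \<subseteq> positive_part"
    using assms by (intro span_minimal subspace_positive_part) (auto simp: vacuum_radical_def)
  then show ?thesis
    using mode_mode by (auto simp: vacuum_radical_def)
qed

text \<open>
  A subspace closed under \<open>L(-1)\<close> contains \<open>L(-1)\<^sup>i x / i!\<close> with \<open>x\<close>. This is what skew symmetry
  needs in order to turn closure under left products into closure under right products.
\<close>
lemma mode_vac_vacuum_radical:
  assumes "x \<in> vacuum_radical"
  shows "mode x (- 1 - int i) vac \<in> vacuum_radical"
  using assms
proof (induction i arbitrary: x)
  case 0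
  then show ?case by (simp add: creation)
next
  case (Suc i)
  have "mode (L (-1) x) (- 1 - int i) vac = of_nat (Suc i) *s mode x (- 1 - int (Suc i)) vac"
    using translation[of x "- 1 - int i" vac] by (simp add: algebra_simps)
  then have "mode x (- 1 - int (Suc i)) vac
      = inverse (of_nat (Suc i)) *s mode (L (-1) x) (- 1 - int i) vac"
    by (simp del: of_nat_Suc)
  moreover have "mode (L (-1) x) (- 1 - int i) vac \<in> vacuum_radical"
    unfolding L_def by (intro Suc.IH mode_vacuum_radical Suc.prems)
  ultimately show ?case
    by (simp add: subspace_scale[OF subspace_vacuum_radical])
qed

end

section \<open>Consequences of strong generation in weights 3/2 and 2\<close>

locale vosa_generated_3_2_2 = vertex_operator_superalgebra scale grade mode vac conf
  for scale :: "complex \<Rightarrow> 'v::ab_group_add \<Rightarrow> 'v" (infixr \<open>*s\<close> 75)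
    and grade mode vac conf +
  assumes generated: "strongly_generated_by (grade (3/2) + grade 2)"
begin

text \<open>
  A creation mode \<open>a\<^sub>-\<^sub>n\<close>, \<open>n > 0\<close>, of a generator raises the weight by at least \<open>3/2\<close>, so every
  generating monomial other than \<open>\<one>\<close> has weight at least \<open>3/2\<close>.
\<close>
lemma span_grade_gap: "span (\<Union>q\<in>{q\<in>half_ints. q = 0 \<or> q \<ge> 3/2}. grade q) = UNIV"
  (is "span ?H = UNIV")
proof -
  have step: "mode a (- n) x \<in> span ?H"
    if a: "a \<in> grade p" "p = 3/2 \<or> p = 2" and n: "n > 0" and x: "x \<in> span ?H" for a p x n
  proof (rule mode_in_subspace[OF _ _ x])
    have p: "p \<in> half_ints"
      by (rule half_ints_3_2_or_2[OF a(2)])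
    fix y assume "y \<in> ?H"
    then obtain q where q: "q \<in> half_ints" "q \<ge> 0" "y \<in> grade q" by auto
    have "mode a (- n) y \<in> grade (p + q + of_int (n - 1))"
      using grade_mode[OF p q(1) a(1) q(3), of "- n"] by simp
    moreover have "p + q + of_int (n - 1) \<in> half_ints"
      by (intro half_ints_add p q half_ints_of_int)
    moreover have "of_int (n - 1) \<ge> (0::rat)"
      using n by (subst of_int_0_le_iff) simp
    then have "p + q + of_int (n - 1) \<ge> 3/2"
      using a(2) q(2) by linarith
    ultimately show "mode a (- n) y \<in> span ?H"
      by (intro span_base) blast
  qed simp
  have vac: "vac \<in> span ?H"
    by (rule span_base) (use vac_grade half_ints_0 in auto)
  have "foldr (\<lambda>(a, n). mode a (- n)) xs vac \<in> span ?H"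
    if "\<forall>(a, n)\<in>set xs. a \<in> grade (3/2) + grade 2 \<and> n > 0" for xs :: "('v \<times> int) list"
    using that
  proof (induction xs)
    case Nil
    then show ?case using vac by simp
  next
    case (Cons an xs)
    obtain a n where an: "an = (a, n)" by force
    with Cons obtain u v where uv: "a = u + v" "u \<in> grade (3/2)" "v \<in> grade 2" "n > 0"
      by (auto elim: set_plus_elim)
    let ?y = "foldr (\<lambda>(a, n). mode a (- n)) xs vac"
    have y: "?y \<in> span ?H" using Cons by simp
    have "mode u (- n) ?y + mode v (- n) ?y \<in> span ?H"
      by (intro span_add step[OF uv(2) _ uv(4) y] step[OF uv(3) _ uv(4) y]) auto
    then show ?case by (simp add: an uv(1) mode_left)
  qed
  with vac have "insert vac {foldr (\<lambda>(a, n). mode a (- n)) xs vac | xs :: ('v \<times> int) list.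
      xs \<noteq> [] \<and> (\<forall>(a, n)\<in>set xs. a \<in> grade (3/2) + grade 2 \<and> n > 0)} \<subseteq> span ?H"
    by blast
  from span_minimal[OF this] generated show ?thesis
    unfolding strongly_generated_by_def by auto
qed

lemma grade_gap:
  assumes "q \<in> half_ints" "q \<noteq> 0" "q < 3/2"
  shows "grade q = {0}"
proof -
  have "v = 0" if "v \<in> grade q" for v
    using assms that
    by (intro grade_independent[of q "{q\<in>half_ints. q = 0 \<or> q \<ge> 3/2}"])
      (simp_all only: span_grade_gap, auto)
  then show ?thesis
    using subspace_0[OF subspace_grade[OF assms(1)]] by blast
qed

lemma mode_in_subspace_by_weight:
  assumes "\<And>q v. q \<in> half_ints \<Longrightarrow> q = 0 \<or> q \<ge> 3/2 \<Longrightarrow> v \<in> grade q \<Longrightarrow> mode u n v \<in> S" "subspace S"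
  shows "mode u n v \<in> S"
  by (rule mode_in_subspace[where B = "\<Union>q\<in>{q\<in>half_ints. q = 0 \<or> q \<ge> 3/2}. grade q"])
    (use assms span_grade_gap in auto)

lemma grade_nonzero_positive_part:
  assumes "q \<in> half_ints" "q \<noteq> 0" "v \<in> grade q"
  shows "v \<in> positive_part"
proof (cases "q > 0")
  case True
  then show ?thesis using assms grade_positive_part by blast
next
  case False
  then have "v = 0" using grade_gap[OF assms(1,2)] assms(2,3) by auto
  then show ?thesis by (simp add: subspace_0[OF subspace_positive_part])
qed

text \<open>Odd vectors have half-odd weights, and these are never \<open>0\<close>.\<close>
lemma odd_positive_part: "parity 1 \<subseteq> positive_part"
  unfolding parity_def
proof (intro span_minimal subspace_positive_part UN_least subsetI)
  fix n :: int and x assume x: "x \<in> grade (of_int n + (if (1::bit) = 0 then 0 else 1/2))"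
  have "of_int n + 1/2 = (of_int (2 * n + 1) / 2 :: rat)"
    by (simp add: field_simps)
  then have 1: "of_int n + 1/2 \<in> half_ints"
    unfolding half_ints_def by blast
  have "(2 * of_int n + 1 :: rat) = of_int (2 * n + 1)" by simp
  also have "\<dots> \<noteq> 0" by (subst of_int_eq_0_iff) presburger
  finally have "of_int n + 1/2 \<noteq> (0::rat)" by (simp add: field_simps)
  with 1 x show "x \<in> positive_part"
    by (intro grade_nonzero_positive_part) auto
qed

text \<open>
  The vacuum is even. Testing \<open>x + y\<close> with an even \<open>v\<close> therefore only sees \<open>x\<close>, while an odd \<open>v\<close>
  sends \<open>x\<close> to an odd vector. This makes the vacuum radical a graded subspace for the parity,
  which skew symmetry, stated for vectors of definite parity, requires.
\<close>
lemma even_component_vacuum_radical: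
  assumes "x + y \<in> vacuum_radical" "x \<in> parity 0" "y \<in> parity 1"
  shows "x \<in> vacuum_radical"
proof -
  have "mode v n x \<in> positive_part" if v: "v \<in> parity 0 \<union> parity 1" for v n
    using v
  proof
    assume "v \<in> parity 0"
    from mode_parity[OF this assms(3)] odd_positive_part have "mode v n y \<in> positive_part" by auto
    moreover have "mode v n (x + y) \<in> positive_part"
      using assms(1) by (simp add: vacuum_radical_def)
    ultimately have "mode v n (x + y) - mode v n y \<in> positive_part"
      by (intro subspace_diff subspace_positive_part)
    then show ?thesis by (simp add: mode_right)
  next
    assume "v \<in> parity 1"
    from mode_parity[OF this assms(2)] odd_positive_part show ?thesis by auto
  qed
  then have "mode v n x \<in> positive_part" for v n
    using mode_in_subspace_left[OF subspace_positive_part] span_parity UNIV_I by metis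
  then show ?thesis by (simp add: vacuum_radical_def)
qed

lemma vacuum_radical_mode:
  assumes x: "x \<in> vacuum_radical"
  shows "mode x n w \<in> vacuum_radical"
proof -
  have hom: "mode y n w \<in> vacuum_radical" if y: "y \<in> vacuum_radical" "y \<in> parity \<alpha>" for y \<alpha>
  proof (rule mode_in_subspace[OF subspace_vacuum_radical])
    show "w \<in> span (parity 0 \<union> parity 1)" by (simp add: span_parity)
  next
    fix b assume "b \<in> parity 0 \<union> parity 1"
    then obtain \<beta> where b: "b \<in> parity \<beta>" by blast
    show "mode y n b \<in> vacuum_radical"
      by (intro skew_symmetry_subspace[OF b y(2)] subspace_vacuum_radical
          mode_vac_vacuum_radical mode_vacuum_radical y(1))
  qed
  have "x \<in> span (parity 0 \<union> parity 1)" by (simp add: span_parity)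
  then obtain y z where yz: "x = y + z" "y \<in> parity 0" "z \<in> parity 1"
    unfolding span_Un span_parity_self by blast
  have y: "y \<in> vacuum_radical"
    using even_component_vacuum_radical x yz by simp
  have "z = x - y" by (simp add: yz(1))
  with x y have z: "z \<in> vacuum_radical"
    using subspace_diff[OF subspace_vacuum_radical] by simp
  show ?thesis
    using subspace_add[OF subspace_vacuum_radical hom[OF y yz(2)] hom[OF z yz(3)]]
    by (simp add: yz(1) mode_left)
qed

lemma vacuum_radical_zero:
  assumes simple
  shows "vacuum_radical = {0}"
proof -
  have "vac \<notin> vacuum_radical"
  proof
    assume "vac \<in> vacuum_radical"
    then have "mode vac (-1) vac \<in> positive_part" by (simp add: vacuum_radical_def)
    then show False
      using vac_positive_part simple_vac_nonzero[OF assms] by (simp add: creation)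
  qed
  moreover have "ideal vacuum_radical"
    unfolding ideal_def
    using subspace_vacuum_radical mode_vacuum_radical vacuum_radical_mode by blast
  ultimately show ?thesis
    using assms unfolding simple_def by blast
qed

section \<open>The kernels of the forms\<close>

text \<open>The vector \<open>z\<^sub>-\<^sub>1\<^sub>-\<^sub>i \<one>\<close> is a multiple of \<open>L(-1)\<^sup>i z\<close>, of weight at least \<open>i\<close>.\<close>
lemma mode_vac_positive_part: "mode z (- 1 - int (Suc i)) vac \<in> positive_part"
proof (rule mode_in_subspace_left[OF subspace_positive_part])
  show "z \<in> span (\<Union>q\<in>{q\<in>half_ints. q = 0 \<or> q \<ge> 3/2}. grade q)"
    by (simp only: span_grade_gap UNIV_I)
next
  fix b assume "b \<in> (\<Union>q\<in>{q\<in>half_ints. q = 0 \<or> q \<ge> 3/2}. grade q)"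
  then obtain q where q: "q \<in> half_ints" "q \<ge> 0" "b \<in> grade q" by auto
  have "mode b (- 1 - int (Suc i)) vac \<in> grade (q + of_int (int (Suc i)))"
    using grade_mode[OF q(1) half_ints_0 q(3) vac_grade, of "- 1 - int (Suc i)"] by simp
  moreover have "q + of_int (int (Suc i)) \<in> half_ints"
    by (intro half_ints_add q(1) half_ints_of_int)
  moreover have "q + of_int (int (Suc i)) > 0"
    using q(2) by (intro add_nonneg_pos) auto
  ultimately show "mode b (- 1 - int (Suc i)) vac \<in> positive_part"
    by (intro grade_positive_part)
qed

text \<open>Only the term \<open>i = 0\<close> of skew symmetry, \<open>u\<^sub>m v\<close> itself, can have a vacuum component.\<close>
lemma mode_swap_positive_part:
  assumes u: "u \<in> parity \<alpha>" and v: "v \<in> parity \<beta>" and uv: "mode u m v \<in> positive_part"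
  shows "mode v m u \<in> positive_part"
proof (rule skew_symmetry_subspace[OF u v subspace_positive_part])
  fix i show "mode (mode u (m + int i) v) (- 1 - int i) vac \<in> positive_part"
  proof (cases i)
    case 0
    then show ?thesis using uv by (simp add: creation)
  next
    case (Suc j)
    then show ?thesis using mode_vac_positive_part by blast
  qed
qed

text \<open>Weight \<open>0\<close> is killed, weight \<open>1\<close> is empty, and weights \<open>q \<ge> 3/2\<close> go to \<open>q - 1 > 0\<close>.\<close>
lemma L1_positive_part: "L 1 v \<in> positive_part"
  unfolding L_def
proof (rule mode_in_subspace_by_weight[OF _ subspace_positive_part])
  fix q v assume q: "q \<in> half_ints" "q = 0 \<or> q \<ge> 3/2" "v \<in> grade q"
  show "mode conf (1 + 1) v \<in> positive_part"
  proof (cases "q = 0")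
    case True
    then obtain c where "v = c *s vac"
      using q(3) grade_0[OF generated] by (auto simp: span_singleton)
    then show ?thesis
      by (simp add: mode_right creation_regular subspace_0[OF subspace_positive_part])
  next
    case False
    then show ?thesis
      using grade_positive_part[OF half_ints_diff_int[OF q(1), of 1]] L_grade[OF q(1,3), of 1] q(2)
      by (simp add: L_def)
  qed
qed

text \<open>
  The form only controls \<open>a\<^sub>d\<close> with \<open>d = 2h - 1\<close>. Higher modes are reached through
  \<open>[L(1), a\<^sub>n] = (2h - 2 - n) a\<^sub>n\<^sub>+\<^sub>1\<close>, since \<open>L(1)\<close> contributes no vacuum component. Lower modes
  could only reach the vacuum from a weight smaller than \<open>h\<close>; that leaves weight \<open>0\<close>, where the
  mode in question is \<open>a\<^sub>h\<^sub>-\<^sub>1\<close> and kills the vacuum because \<open>h - 1 \<ge> 0\<close>, and weight \<open>3/2\<close> against \<open>h = 2\<close>, where the mode index would not be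
  an integer.
\<close>
lemma form_kernel_positive_part:
  fixes h :: rat and d :: int
  assumes h: "h = 3/2 \<or> h = 2" and d: "of_int d = 2 * h - 1"
    and a: "a \<in> grade h" and ker: "\<And>b. b \<in> grade h \<Longrightarrow> mode a d b \<in> positive_part"
  shows "mode a n v \<in> positive_part"
proof -
  have hh: "h \<in> half_ints"
    by (rule half_ints_3_2_or_2[OF h])
  obtain \<alpha> where \<alpha>: "a \<in> parity \<alpha>" using grade_parity[OF hh a] .
  \<comment> \<open>Only the weight \<open>n + 1 - h\<close> is mapped to weight \<open>0\<close> by \<open>a\<^sub>n\<close>.\<close>
  have deg: "mode a n v \<in> positive_part"
    if v: "q \<in> half_ints" "v \<in> grade q" and q: "q \<noteq> of_int n + 1 - h" for q v n
  proof (rule grade_nonzero_positive_part[OF _ _ grade_mode[OF hh v(1) a v(2)]])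
    show "h + q + of_int (- n - 1) \<in> half_ints"
      by (intro half_ints_add hh v(1) half_ints_of_int)
    show "h + q + of_int (- n - 1) \<noteq> 0"
    proof
      assume "h + q + of_int (- n - 1) = 0"
      then have "q = of_int n + 1 - h" unfolding of_int_diff of_int_minus of_int_1 by linarith
      with q show False by blast
    qed
  qed
  have "L 1 a \<in> grade (h - 1)"
    using L_grade[OF hh a, of 1] by simp
  then have L1a: "L 1 a = 0"
    using grade_gap[of "h - 1"] half_ints_diff_int[OF hh, of 1] h by auto
  have L0a: "L 0 a = of_rat h *s a"
    using a hh by (simp add: grade_eigenspace)
  \<comment> \<open>The relation between \<open>d\<close> and \<open>h\<close> carried over to the scalars that occur in \<open>L1_mode\<close>.\<close>
  have dh: "of_int d = (2 * of_rat h - 1 :: complex)"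
    using arg_cong[OF d, of "of_rat :: rat \<Rightarrow> complex"] by (simp add: of_rat_diff of_rat_mult)
  have up: "mode a (d + int j) v \<in> positive_part" for j v
  proof (induction j arbitrary: v)
    case 0
    show ?case
    proof (rule mode_in_subspace_by_weight[OF _ subspace_positive_part])
      fix q v assume q: "q \<in> half_ints" "v \<in> grade q"
      show "mode a (d + int 0) v \<in> positive_part"
        using ker deg[OF q, of d] q d by (cases "q = h") auto
    qed
  next
    case (Suc j)
    let ?m = "d + int j"
    have "L 1 (mode a ?m v) - mode a ?m (L 1 v) = - (of_nat (Suc j) *s mode a (?m + 1) v)"
      by (simp add: L1_mode[OF \<alpha>] L0a L1a mode_left dh algebra_simps)
    moreover have "L 1 (mode a ?m v) - mode a ?m (L 1 v) \<in> positive_part"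
      by (intro subspace_diff subspace_positive_part L1_positive_part Suc.IH)
    ultimately have "(- inverse (of_nat (Suc j))) *s (- (of_nat (Suc j) *s mode a (?m + 1) v)) \<in> positive_part"
      by (intro subspace_scale subspace_positive_part) simp
    moreover have "?m + 1 = d + int (Suc j)" by simp
    ultimately show ?case by (simp del: of_nat_Suc)
  qed
  show ?thesis
  proof (cases "n \<ge> d")
    case True
    then show ?thesis using up[of "nat (n - d)" v] by simp
  next
    case False
    show ?thesis
    proof (rule mode_in_subspace_by_weight[OF _ subspace_positive_part])
      fix q v assume q: "q \<in> half_ints" "q = 0 \<or> q \<ge> 3/2" "v \<in> grade q"
      show "mode a n v \<in> positive_part"
      proof (cases "q = of_int n + 1 - h")
        case eq: True
        have "q = 0"
        proof (rule ccontr)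
          assume "q \<noteq> 0"
          then have n: "of_int n \<ge> 1/2 + h" using q(2) eq by auto
          from False have "of_int n \<le> (of_int (d - 1) :: rat)" by (subst of_int_le_iff) simp
          then have "of_int n \<le> 2 * h - 2" using d by simp
          with n h show False by auto
        qed
        then obtain c where c: "v = c *s vac"
          using q(3) grade_0[OF generated] by (auto simp: span_singleton)
        have "of_int n \<ge> (0::rat)" using eq \<open>q = 0\<close> h by auto
        then have "n \<ge> 0" by simp
        then show ?thesis
          by (simp add: c mode_right creation_regular subspace_0[OF subspace_positive_part])
      qed (rule deg[OF q(1,3)])
    qed
  qed
qed

lemma form_kernel_zero:
  fixes h :: rat and d :: int
  assumes simple and h: "h = 3/2 \<or> h = 2" and d: "of_int d = 2 * h - 1"
    and a: "a \<in> grade h" and ker: "\<And>b. b \<in> grade h \<Longrightarrow> mode a d b \<in> positive_part"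
  shows "a = 0"
proof -
  have hh: "h \<in> half_ints"
    by (rule half_ints_3_2_or_2[OF h])
  obtain \<alpha> where \<alpha>: "a \<in> parity \<alpha>" using grade_parity[OF hh a] .
  have "mode v n a \<in> positive_part" for v n
  proof (rule mode_in_subspace_left[OF subspace_positive_part])
    show "v \<in> span (parity 0 \<union> parity 1)" by (simp add: span_parity)
    fix b assume "b \<in> parity 0 \<union> parity 1"
    then show "mode b n a \<in> positive_part"
      using mode_swap_positive_part[OF \<alpha>] form_kernel_positive_part[OF h d a ker] by blast
  qed
  then show ?thesis
    using vacuum_radical_zero[OF assms(1)] by (auto simp: vacuum_radical_def)
qed

section \<open>Non-degeneracy\<close>

lemma nondegenerate_form:
  fixes h :: rat and d :: int
  assumes simple and h: "h = 3/2 \<or> h = 2" and d: "of_int d = 2 * h - 1"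
    and form: "\<And>a b. a \<in> grade h \<Longrightarrow> b \<in> grade h \<Longrightarrow> mode a d b = form d a b *s vac"
  shows "nondegenerate_bilinear_form_on (grade h) (form d)"
  unfolding nondegenerate_bilinear_form_on_def bilinear_form_on_def
proof (intro conjI ballI allI impI)
  have hh: "h \<in> half_ints"
    by (rule half_ints_3_2_or_2[OF h])
  have sub: "subspace (grade h)" by (rule subspace_grade[OF hh])
  have eqI: "form d a b = c"
    if "mode a d b = c *s vac" "a \<in> grade h" "b \<in> grade h" for a b c
    using that form[of a b] simple_vac_nonzero[OF assms(1)] by simp
  show "form d (x + y) z = form d x z + form d y z"
    if "x \<in> grade h" "y \<in> grade h" "z \<in> grade h" for x y z
    using that by (intro eqI) (simp_all add: mode_left form scale_left_distrib subspace_add[OF sub])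
  show "form d z (x + y) = form d z x + form d z y"
    if "x \<in> grade h" "y \<in> grade h" "z \<in> grade h" for x y z
    using that by (intro eqI) (simp_all add: mode_right form scale_left_distrib subspace_add[OF sub])
  show "form d (c *s x) y = c * form d x y"
    if "x \<in> grade h" "y \<in> grade h" for c x y
    using that by (intro eqI) (simp_all add: mode_left form subspace_scale[OF sub])
  show "form d x (c *s y) = c * form d x y"
    if "x \<in> grade h" "y \<in> grade h" for c x y
    using that by (intro eqI) (simp_all add: mode_right form subspace_scale[OF sub])
  show "x = 0" if x: "x \<in> grade h" and 0: "\<forall>y\<in>grade h. form d x y = 0" for x
    by (rule form_kernel_zero[OF assms(1) h d x])
      (simp add: form x 0 subspace_0[OF subspace_positive_part])
  show "y = 0" if y: "y \<in> grade h" and 0: "\<forall>x\<in>grade h. form d x y = 0" for y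
  proof (rule form_kernel_zero[OF assms(1) h d y])
    fix b assume b: "b \<in> grade h"
    obtain \<alpha> \<beta> where "b \<in> parity \<alpha>" "y \<in> parity \<beta>"
      using grade_parity[OF hh] b y by metis
    then show "mode y d b \<in> positive_part"
      by (rule mode_swap_positive_part)
        (simp add: form y b 0 subspace_0[OF subspace_positive_part])
  qed
qed

end

theorem corollary3p21:
  fixes scale :: "complex \<Rightarrow> 'v::ab_group_add \<Rightarrow> 'v"
    and grade :: "rat \<Rightarrow> 'v set"
    and mode :: "'v \<Rightarrow> int \<Rightarrow> 'v \<Rightarrow> 'v"
    and vac conf :: 'v
  assumes "vertex_operator_superalgebra scale grade mode vac conf"
    and "vosa_data.simple scale mode"
    and "vosa_data.strongly_generated_by scale mode vac (grade (3/2) + grade 2)"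
  shows "vosa_data.nondegenerate_bilinear_form_on scale (grade 2)
           (vosa_data.form scale mode vac 3)
       \<and> vosa_data.nondegenerate_bilinear_form_on scale (grade (3/2))
           (vosa_data.form scale mode vac 2)"
proof -
  interpret vertex_operator_superalgebra scale grade mode vac conf by (rule assms(1))
  interpret vosa_generated_3_2_2 scale grade mode vac conf
    by unfold_locales (rule assms(3))
  show ?thesis
    using nondegenerate_form[OF assms(2), of 2 3] form_2[OF assms(2,3)]
      nondegenerate_form[OF assms(2), of "3/2" 2] form_3_2[OF assms(2,3)]
    by simp
qed

end
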